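(* Let $n_1,n_2,n_3\ge 1$. For any tensor $\mathcal{T}\in\mathbb{R}^{n_1\times n_2\times n_3}$, $\operatorname{rank}_*(\mathcal{T})\le n_1n_2n_3$.
   Context: $\otimes$ is the vector outer product and $\|\cdot\|$ on vectors is the Euclidean norm. The tensor nuclear norm of $\mathcal{T}\in\mathbb{R}^{n_1\times n_2\times n_3}$ is $$\|\mathcal{T}\|_*=\min\left\{\sum_{r=1}^R|\lambda_r|:\ \mathcal{T}=\sum_{r=1}^R\lambda_r\,\mathbf{x}_1^{(r)}\otimes\mathbf{x}_2^{(r)}\otimes\mathbf{x}_3^{(r)},\ R\in\mathbb{N},\ \lambda_r\in\mathbb{R},\ \mathbf{x}_\ell^{(r)}\in\mathbb{R}^{n_\ell},\ \|\mathbf{x}_\ell^{(r)}\|=1\ \forall \ell\in\{1,2,3\},\,r\in\{1,\dots,R\}\right\}$$ (the minimum is attained). The nuclear rank of $\mathcal{T}$ is the smallest length of a decomposition attaining the nuclear norm: $$\operatorname{rank}_*(\mathcal{T})=\min\left\{R\in\mathbb{N}:\ \mathcal{T}=\sum_{r=1}^R\lambda_r\,\mathbf{x}_1^{(r)}\otimes\mathbf{x}_2^{(r)}\otimes\mathbf{x}_3^{(r)},\ \|\mathcal{T}\|_*=\sum_{r=1}^R|\lambda_r|,\ \|\mathbf{x}_\ell^{(r)}\|=1\ \forall\ell\in\{1,2,3\},\,r\in\{1,\dots,R\}\right\}.$$ *)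

theory Defs
  imports "HOL-Analysis.Analysis"
begin

text \<open>
  A tensor of format \<open>n\<^sub>1 \<times> n\<^sub>2 \<times> n\<^sub>3\<close> is an element of \<open>real ^ 'n3 ^ 'n2 ^ 'n1\<close>, with entries
  \<open>T $ i $ j $ k\<close> for \<open>i :: 'n1\<close>, \<open>j :: 'n2\<close>, \<open>k :: 'n3\<close>. The dimensions are \<open>CARD('n1)\<close>,
  \<open>CARD('n2)\<close>, \<open>CARD('n3)\<close>, which are automatically positive.
\<close>

definition outer3 ::
  "real ^ 'n1 \<Rightarrow> real ^ 'n2 \<Rightarrow> real ^ 'n3 \<Rightarrow> real ^ 'n3 ^ 'n2 ^ 'n1" where
  "outer3 x y z = (\<chi> i j k. x $ i * y $ j * z $ k)"

text \<open>The length \<open>R = 0\<close> is admitted: the zero tensor is the empty sum.\<close>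

definition unit_decomposition ::
  "real ^ 'n3 ^ 'n2 ^ 'n1 \<Rightarrow> nat \<Rightarrow> (nat \<Rightarrow> real) \<Rightarrow>
    (nat \<Rightarrow> real ^ 'n1) \<Rightarrow> (nat \<Rightarrow> real ^ 'n2) \<Rightarrow> (nat \<Rightarrow> real ^ 'n3) \<Rightarrow> bool" where
  "unit_decomposition T R c x y z \<longleftrightarrow>
    T = (\<Sum>r=1..R. c r *\<^sub>R outer3 (x r) (y r) (z r)) \<and>
    (\<forall>r\<in>{1..R}. norm (x r) = 1 \<and> norm (y r) = 1 \<and> norm (z r) = 1)"

text \<open>
  Both minima are rendered by \<open>LEAST\<close>, whose value is unspecified when no least element exists.
  Reasoning about them therefore requires showing that they are attained.
\<close>

definition nuclear_norm :: "real ^ 'n3 ^ 'n2 ^ 'n1 \<Rightarrow> real" where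
  "nuclear_norm T =
    (LEAST s. \<exists>R c x y z. unit_decomposition T R c x y z \<and> s = (\<Sum>r=1..R. \<bar>c r\<bar>))"

definition nuclear_rank :: "real ^ 'n3 ^ 'n2 ^ 'n1 \<Rightarrow> nat" where
  "nuclear_rank T =
    (LEAST R. \<exists>c x y z. unit_decomposition T R c x y z \<and> nuclear_norm T = (\<Sum>r=1..R. \<bar>c r\<bar>))"

end

theory Submission
  imports Defs
begin

text \<open>
  Let \<open>C\<close> be the convex hull of the compact symmetric set \<open>K\<close> of unit rank-one tensors; the nuclear
  norm is the gauge of \<open>C\<close>. For \<open>T \<noteq> 0\<close> let \<open>t\<close> be maximal with \<open>t T \<in> C\<close>. A hyperplane separating
  \<open>C\<close> from the open ray beyond \<open>t T\<close> cuts out a face of \<open>C\<close> which contains \<open>t T\<close> and which is the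
  convex hull of points of \<open>K\<close> in that hyperplane. Its affine dimension is at most one less than
  that of the tensor space, so Caratheodory's theorem writes \<open>t T\<close> as a convex combination of at most
  \<open>n\<^sub>1 n\<^sub>2 n\<^sub>3\<close> points of \<open>K\<close>.
\<close>

text \<open>Symmetry of \<open>K\<close> lets each vector absorb the sign of its coefficient;
  dividing by the total weight then leaves a convex combination. This is how the cost of an
  arbitrary decomposition is compared with the gauge.\<close>

lemma sum_in_scaled_convex_hull:
  fixes x :: "'a::real_vector"
  assumes sym: "\<And>u. u \<in> K \<Longrightarrow> - u \<in> K"
    and w: "\<And>r. r \<in> I \<Longrightarrow> w r \<in> K"
    and "finite I"
    and x: "x = (\<Sum>r\<in>I. d r *\<^sub>R w r)" "x \<noteq> 0"
  shows "0 < (\<Sum>r\<in>I. \<bar>d r\<bar>)" and "inverse (\<Sum>r\<in>I. \<bar>d r\<bar>) *\<^sub>R x \<in> convex hull K"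
proof -
  let ?s = "\<Sum>r\<in>I. \<bar>d r\<bar>"
  show pos: "0 < ?s"
  proof (rule ccontr)
    assume "\<not> 0 < ?s"
    then have "?s = 0" by (smt (verit) sum_nonneg abs_ge_zero)
    then have "\<forall>r\<in>I. d r = 0" using \<open>finite I\<close> by (simp add: sum_nonneg_eq_0_iff)
    with x show False by simp
  qed
  define e where "e r = (if d r < 0 then - w r else w r)" for r
  have "(\<Sum>r\<in>I. (\<bar>d r\<bar> / ?s) *\<^sub>R e r) \<in> convex hull K"
  proof (rule convex_sum[OF \<open>finite I\<close> convex_convex_hull])
    show "(\<Sum>r\<in>I. \<bar>d r\<bar> / ?s) = 1" using pos by (simp flip: sum_divide_distrib)
    show "e r \<in> convex hull K" if "r \<in> I" for r
      using w[OF that] sym by (simp add: e_def hull_inc)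
  qed (use pos in auto)
  also have "(\<Sum>r\<in>I. (\<bar>d r\<bar> / ?s) *\<^sub>R e r) = inverse ?s *\<^sub>R x"
    unfolding x(1) scaleR_sum_right by (intro sum.cong) (auto simp: e_def divide_inverse mult.commute)
  finally show "inverse ?s *\<^sub>R x \<in> convex hull K" .
qed

text \<open>The minimizer is a set of vectors, while its competitors are indexed families, which may
  repeat vectors as decompositions of a tensor may.\<close>

proposition minimal_decomposition_card_le_DIM:
  fixes x :: "'a::euclidean_space"
  assumes "compact K" and sym: "\<And>u. u \<in> K \<Longrightarrow> - u \<in> K"
    and total: "\<And>a. (\<And>u. u \<in> K \<Longrightarrow> a \<bullet> u = 0) \<Longrightarrow> a = 0"
  obtains S c where "finite S" "S \<subseteq> K" "card S \<le> DIM('a)" "x = (\<Sum>v\<in>S. c v *\<^sub>R v)"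
    "\<And>(I :: 'i set) d w. \<lbrakk>finite I; w ` I \<subseteq> K; x = (\<Sum>r\<in>I. d r *\<^sub>R w r)\<rbrakk>
      \<Longrightarrow> (\<Sum>v\<in>S. \<bar>c v\<bar>) \<le> (\<Sum>r\<in>I. \<bar>d r\<bar>)"
proof (cases "x = 0")
  case True
  show ?thesis by (rule that[of "{}"]) (auto simp: True sum_nonneg)
next
  case False
  define C where "C = convex hull K"
  have "compact C" "convex C" using \<open>compact K\<close> by (auto simp: C_def compact_convex_hull)
  have "K \<noteq> {}"
    using total[of x] False by blast
  then obtain u where "u \<in> K" by blast
  then have "(1/2) *\<^sub>R u + (1/2) *\<^sub>R (- u) \<in> C"
    unfolding C_def by (intro convexD[OF convex_convex_hull] hull_inc sym) auto
  then have "0 \<in> C" by simp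
  define A where "A = (\<lambda>t. t *\<^sub>R x) -` C"
  have "closed A" unfolding A_def
    by (rule closed_vimage[OF compact_imp_closed[OF \<open>compact C\<close>]]) (intro continuous_intros)
  moreover obtain B where B: "\<And>y. y \<in> C \<Longrightarrow> norm y \<le> B"
    using compact_imp_bounded[OF \<open>compact C\<close>] by (auto simp: bounded_iff)
  have "bounded A"
    unfolding bounded_iff
  proof (intro exI ballI)
    fix t assume "t \<in> A"
    then show "norm t \<le> B / norm x"
      using B[of "t *\<^sub>R x"] False by (simp add: A_def field_simps)
  qed
  moreover have "0 \<in> A" using \<open>0 \<in> C\<close> by (simp add: A_def)
  ultimately obtain t where "t \<in> A" and tmax: "\<And>s. s \<in> A \<Longrightarrow> s \<le> t"
    using compact_attains_sup[of A] by (auto simp: compact_eq_bounded_closed)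
  have "0 \<le> t" using tmax \<open>0 \<in> A\<close> by blast
  have tC: "t *\<^sub>R x \<in> C" using \<open>t \<in> A\<close> by (simp add: A_def)
  \<comment> \<open>The endpoint \<open>t *\<^sub>R x\<close> lies in \<open>C\<close>, so the ray
    must be open to be disjoint from \<open>C\<close>.\<close>
  let ?ray = "(\<lambda>s. s *\<^sub>R x) ` {t<..}"
  have "convex ?ray" by (intro convex_linear_image linearI) (auto simp: algebra_simps)
  moreover have "C \<inter> ?ray = {}" using tmax by (fastforce simp: A_def)
  moreover have "C \<noteq> {}" "?ray \<noteq> {}" using \<open>0 \<in> C\<close> by auto
  ultimately obtain a b where "a \<noteq> 0" and le: "\<And>y. y \<in> C \<Longrightarrow> a \<bullet> y \<le> b"
    and "\<forall>y\<in>?ray. b \<le> a \<bullet> y"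
    using separating_hyperplane_sets[OF \<open>convex C\<close>] by metis
  then have ray: "b \<le> s * (a \<bullet> x)" if "s > t" for s
    using that by force
  \<comment> \<open>Letting \<open>s\<close> decrease to \<open>t\<close> carries the bound to the
    endpoint, so the hyperplane touches \<open>C\<close> at \<open>t *\<^sub>R x\<close>.\<close>
  have "b \<le> t * (a \<bullet> x)"
  proof (rule tendsto_lowerbound)
    show "((\<lambda>s. s * (a \<bullet> x)) \<longlongrightarrow> t * (a \<bullet> x)) (at_right t)" by (intro tendsto_intros)
    show "\<forall>\<^sub>F s in at_right t. b \<le> s * (a \<bullet> x)"
      using ray by (auto simp: eventually_at_filter)
  qed simp
  then have b: "a \<bullet> (t *\<^sub>R x) = b" using le[OF tC] by simp
  \<comment> \<open>If \<open>t = 0\<close>, the hyperplane passes through the origin, and symmetry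
    forces \<open>a\<close> to vanish on all of \<open>K\<close>.\<close>
  have "t > 0"
  proof (rule ccontr)
    assume "\<not> t > 0"
    then have "b = 0" using b \<open>0 \<le> t\<close> by simp
    have "a \<bullet> u = 0" if "u \<in> K" for u
      using le[of u] le[of "- u"] sym[OF that] that \<open>b = 0\<close>
      by (simp add: C_def hull_inc)
    then show False using total \<open>a \<noteq> 0\<close> by blast
  qed
  have "(C \<inter> {y. a \<bullet> y = b}) face_of C"
    by (rule face_of_Int_supporting_hyperplane_le[OF \<open>convex C\<close> le])
  then obtain F where F: "F \<subseteq> K" "C \<inter> {y. a \<bullet> y = b} = convex hull F"
    using face_of_convex_hull_subset[OF \<open>compact K\<close>] unfolding C_def by metis
  have "F \<subseteq> {y. a \<bullet> y = b}" using F(2) hull_subset[of F convex] by blast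
  \<comment> \<open>Caratheodory needs \<open>aff_dim F + 1\<close> points, so lying in a hyperplane
    saves exactly the one point that separates \<open>DIM('a) + 1\<close> from the claimed
    bound.\<close>
  then have "aff_dim F \<le> DIM('a) - 1"
    using aff_dim_subset[of F] aff_dim_hyperplane[OF \<open>a \<noteq> 0\<close>] by metis
  moreover have "t *\<^sub>R x \<in> convex hull F" using F(2) tC b by blast
  ultimately obtain S c where S: "finite S" "S \<subseteq> F" "card S \<le> DIM('a)"
    and c: "\<And>v. v \<in> S \<Longrightarrow> 0 \<le> c v" "sum c S = 1" "(\<Sum>v\<in>S. c v *\<^sub>R v) = t *\<^sub>R x"
    unfolding convex_hull_caratheodory_aff_dim by fastforce
  show ?thesis
  proof (rule that[of S "\<lambda>v. c v / t"])
    show "finite S" "S \<subseteq> K" "card S \<le> DIM('a)" using S F(1) by auto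
    have "x = inverse t *\<^sub>R (t *\<^sub>R x)" using \<open>t > 0\<close> by simp
    also have "\<dots> = (\<Sum>v\<in>S. (c v / t) *\<^sub>R v)"
      by (simp only: c(3)[symmetric] scaleR_sum_right) (simp add: divide_inverse mult.commute)
    finally show "x = (\<Sum>v\<in>S. (c v / t) *\<^sub>R v)" .
    fix I :: "'i set" and d w
    assume I: "finite I" "w ` I \<subseteq> K" "x = (\<Sum>r\<in>I. d r *\<^sub>R w r)"
    \<comment> \<open>The inverse of the competing cost belongs to \<open>A\<close>, hence is at
      most \<open>t\<close>; the cost of \<open>S\<close> is exactly \<open>1 / t\<close>.\<close>
    have *: "0 < (\<Sum>r\<in>I. \<bar>d r\<bar>)" "inverse (\<Sum>r\<in>I. \<bar>d r\<bar>) \<le> t"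
      using sum_in_scaled_convex_hull[of K I w x d] sym I False tmax
      by (auto simp: A_def C_def)
    have "(\<Sum>v\<in>S. \<bar>c v / t\<bar>) = sum c S / t"
      using c(1) \<open>t > 0\<close> by (simp add: sum_divide_distrib)
    also have "\<dots> \<le> (\<Sum>r\<in>I. \<bar>d r\<bar>)"
      using * \<open>t > 0\<close> c(2) by (simp add: field_simps)
    finally show "(\<Sum>v\<in>S. \<bar>c v / t\<bar>) \<le> (\<Sum>r\<in>I. \<bar>d r\<bar>)" .
  qed
qed

definition unit_rank_one :: "(real ^ 'n3 ^ 'n2 ^ 'n1) set" where
  "unit_rank_one = (\<lambda>(x, y, z). outer3 x y z) ` (sphere 0 1 \<times> sphere 0 1 \<times> sphere 0 1)"

lemma unit_rank_oneI:
  "\<lbrakk>norm x = 1; norm y = 1; norm z = 1\<rbrakk> \<Longrightarrow> outer3 x y z \<in> unit_rank_one"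
  by (force simp: unit_rank_one_def)

lemma unit_rank_oneE:
  assumes "u \<in> unit_rank_one"
  obtains x y z where "u = outer3 x y z" "norm x = 1" "norm y = 1" "norm z = 1"
  using assms by (auto simp: unit_rank_one_def)

lemma compact_unit_rank_one: "compact unit_rank_one"
  unfolding unit_rank_one_def outer3_def case_prod_unfold
  by (intro compact_continuous_image compact_Times compact_sphere continuous_intros)

lemma uminus_in_unit_rank_one:
  assumes "u \<in> unit_rank_one"
  shows "- u \<in> unit_rank_one"
proof -
  obtain x y z where u: "u = outer3 x y z" "norm x = 1" "norm y = 1" "norm z = 1"
    using assms by (rule unit_rank_oneE)
  have "- u = outer3 (- x) y z" by (simp add: u outer3_def vec_eq_iff)
  then show ?thesis using u by (simp add: unit_rank_oneI)
qed

text \<open>Outer products of standard basis vectors form the standard basis of the tensor space, so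
  only the zero tensor is orthogonal to all of \<open>unit_rank_one\<close>.\<close>

lemma inner_outer3_axis: "a \<bullet> outer3 (axis i 1) (axis j 1) (axis k 1) = a $ i $ j $ k"
proof -
  have "outer3 (axis i 1) (axis j 1) (axis k 1) = axis i (axis j (axis k 1))"
    by (auto simp: outer3_def axis_def vec_eq_iff)
  then show ?thesis by (simp add: inner_axis)
qed

text \<open>A \<open>LEAST\<close> over the reals is determined only once a minimizer is
  exhibited.\<close>

lemma nuclear_norm_eq:
  assumes "unit_decomposition T R c x y z"
    and "\<And>R' c' x' y' z'. unit_decomposition T R' c' x' y' z' \<Longrightarrow>
      (\<Sum>r=1..R. \<bar>c r\<bar>) \<le> (\<Sum>r=1..R'. \<bar>c' r\<bar>)"
  shows "nuclear_norm T = (\<Sum>r=1..R. \<bar>c r\<bar>)"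
  unfolding nuclear_norm_def by (rule Least_equality) (use assms in blast)+

theorem lemma1:
  fixes T :: "real ^ 'n3 ^ 'n2 ^ 'n1"
  shows "nuclear_rank T \<le> CARD('n1) * CARD('n2) * CARD('n3)"
proof -
  have total: "a = 0" if "\<And>u. u \<in> unit_rank_one \<Longrightarrow> a \<bullet> u = 0" for a :: "real ^ 'n3 ^ 'n2 ^ 'n1"
    using that[OF unit_rank_oneI] inner_outer3_axis[of a] by (simp add: vec_eq_iff)
  show ?thesis
  proof (rule minimal_decomposition_card_le_DIM[where x = T, OF compact_unit_rank_one
        uminus_in_unit_rank_one total])
    fix S c
    assume S: "finite S" "S \<subseteq> unit_rank_one" "card S \<le> DIM(real ^ 'n3 ^ 'n2 ^ 'n1)"
      and T: "T = (\<Sum>v\<in>S. c v *\<^sub>R v)"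
      and min: "\<And>(I :: nat set) d w. \<lbrakk>finite I; w ` I \<subseteq> unit_rank_one; T = (\<Sum>r\<in>I. d r *\<^sub>R w r)\<rbrakk>
        \<Longrightarrow> (\<Sum>v\<in>S. \<bar>c v\<bar>) \<le> (\<Sum>r\<in>I. \<bar>d r\<bar>)"
    obtain h where h: "bij_betw h {1..card S} S"
      using ex_bij_betw_nat_finite_1[OF S(1)] by blast
    have "\<forall>r\<in>{1..card S}. \<exists>x y z. h r = outer3 x y z \<and> norm x = 1 \<and> norm y = 1 \<and> norm z = 1"
      using S(2) bij_betw_apply[OF h] by (meson subsetD unit_rank_oneE)
    then obtain x y z where xyz:
      "\<And>r. r \<in> {1..card S} \<Longrightarrow>
        h r = outer3 (x r) (y r) (z r) \<and> norm (x r) = 1 \<and> norm (y r) = 1 \<and> norm (z r) = 1"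
      by metis
    have dec: "unit_decomposition T (card S) (c \<circ> h) x y z"
      unfolding unit_decomposition_def T sum.reindex_bij_betw[OF h, symmetric]
      using xyz by (auto intro!: sum.cong)
    have "(\<Sum>r=1..card S. \<bar>(c \<circ> h) r\<bar>) = (\<Sum>v\<in>S. \<bar>c v\<bar>)"
      using sum.reindex_bij_betw[OF h, of "\<lambda>v. \<bar>c v\<bar>"] by simp
    moreover have "(\<Sum>v\<in>S. \<bar>c v\<bar>) \<le> (\<Sum>r=1..R'. \<bar>c' r\<bar>)"
      if "unit_decomposition T R' c' x' y' z'" for R' c' x' y' z'
      using that by (intro min[where w = "\<lambda>r. outer3 (x' r) (y' r) (z' r)"])
        (auto simp: unit_decomposition_def intro: unit_rank_oneI)
    ultimately have "nuclear_norm T = (\<Sum>r=1..card S. \<bar>(c \<circ> h) r\<bar>)"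
      using nuclear_norm_eq[OF dec] by simp
    \<comment> \<open>Over \<open>nat\<close> a least element exists as soon as some length
      qualifies, so this one optimal decomposition suffices.\<close>
    with dec have "nuclear_rank T \<le> card S"
      unfolding nuclear_rank_def by (intro Least_le) blast
    also have "\<dots> \<le> CARD('n1) * CARD('n2) * CARD('n3)"
      using S(3) by (simp add: mult.assoc)
    finally show ?thesis .
  qed
qed

end
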